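(* Let $T_1$ be a plane tree with an even number $k$ of vertices, let $T_2$ be a plane tree with an even number $l$ of vertices, and let the plane tree $T$ be a sum of $T_1$ and $T_2$. Then $T$ is odd if and only if one of $T_1$, $T_2$ is odd and the other is even.
   Context: A plane tree is a finite tree embedded in the plane (equivalently, a tree with a cyclic counterclockwise order on the edges at each vertex). A plane tree $T$ is a sum of two plane trees $T_1$ and $T_2$ if after deletion of some edge of $T$ one obtains the disjoint union of $T_1$ and $T_2$ (with the induced plane structures). Parity: a pr-tree (plane rooted tree) is obtained from a plane tree by choosing a root vertex and a marked edge incident to the root. The children of each vertex are ordered from left to right: at the root, the edges are taken in counterclockwise order starting from the marked edge, and at any other vertex the edges to children are taken in counterclockwise order starting just after the edge to the parent. The bracket code of a pr-tree whose root has pr-subtrees $T_1',\dots,T_s'$ (left to right) is recursively $(\,c(T_1')\cdots c(T_s')\,)$, where $c(T_i')$ is the code of $T_i'$, and the one-vertex tree has code $()$. An inversion in a bracket code is a pair consisting of a closing bracket and an opening bracket, not necessarily adjacent, such that the closing bracket occurs before the opening bracket. A pr-tree is even if the number of inversions in its bracket code is even, and odd otherwise. For a plane tree with an even number of vertices this parity does not depend on the choice of root vertex and marked edge, so one speaks of even and odd plane trees. *)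

theory Defs
  imports "HOL-Combinatorics.Orbits"
begin

text \<open>
  A plane graph is given combinatorially: \<open>rot G v u\<close> is the neighbour of \<open>v\<close> at the other
  end of the edge that follows the edge \<open>{v, u}\<close> in counterclockwise order around \<open>v\<close>.
  The values of \<open>rot G v\<close> outside the neighbours of \<open>v\<close> carry no meaning.
\<close>

record 'a plane_graph =
  verts :: "'a set"
  edges :: "'a set set"
  rot :: "'a \<Rightarrow> 'a \<Rightarrow> 'a"

definition nbrs :: "'a plane_graph \<Rightarrow> 'a \<Rightarrow> 'a set" where
  "nbrs G v = {u. {v, u} \<in> edges G}"

definition connected_graph :: "'a plane_graph \<Rightarrow> bool" where
  "connected_graph G \<longleftrightarrow>
     (\<forall>u\<in>verts G. \<forall>v\<in>verts G. (u, v) \<in> {(x, y). {x, y} \<in> edges G}\<^sup>*)"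

definition is_cycle :: "'a plane_graph \<Rightarrow> 'a list \<Rightarrow> bool" where
  "is_cycle G c \<longleftrightarrow> length c \<ge> 3 \<and> distinct c \<and>
     (\<forall>i<length c. {c ! i, c ! (Suc i mod length c)} \<in> edges G)"

text \<open>
  The empty case is separated in the last conjunct because \<^const>\<open>cyclic_on\<close> is false on
  the empty set, and the one-vertex tree is a plane tree.
\<close>

definition plane_tree :: "'a plane_graph \<Rightarrow> bool" where
  "plane_tree T \<longleftrightarrow>
     finite (verts T) \<and> verts T \<noteq> {} \<and>
     (\<forall>e\<in>edges T. e \<subseteq> verts T \<and> card e = 2) \<and>
     connected_graph T \<and> (\<nexists>c. is_cycle T c) \<and>
     (\<forall>v\<in>verts T. nbrs T v \<noteq> {} \<longrightarrow> cyclic_on (rot T v) (nbrs T v))"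

text \<open>The induced cyclic orders after deletion of \<open>e\<close> skip over \<open>e\<close>.\<close>

definition delete_edge :: "'a plane_graph \<Rightarrow> 'a set \<Rightarrow> 'a plane_graph" where
  "delete_edge G e =
     \<lparr>verts = verts G,
      edges = edges G - {e},
      rot = (\<lambda>v u. if {v, rot G v u} = e then rot G v (rot G v u) else rot G v u)\<rparr>"

text \<open>Rotations at \<open>Inl x\<close> only matter on neighbours, which are of the form \<open>Inl y\<close>.\<close>

definition disjoint_sum :: "'a plane_graph \<Rightarrow> 'b plane_graph \<Rightarrow> ('a + 'b) plane_graph" where
  "disjoint_sum G H =
     \<lparr>verts = verts G <+> verts H,
      edges = (image Inl) ` edges G \<union> (image Inr) ` edges H,
      rot = (\<lambda>v u. case v of
               Inl x \<Rightarrow> Inl (rot G x (projl u))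
             | Inr x \<Rightarrow> Inr (rot H x (projr u)))\<rparr>"

definition plane_iso :: "'a plane_graph \<Rightarrow> 'b plane_graph \<Rightarrow> bool" where
  "plane_iso G H \<longleftrightarrow>
     (\<exists>f. bij_betw f (verts G) (verts H) \<and>
          (\<forall>u\<in>verts G. \<forall>v\<in>verts G. {f u, f v} \<in> edges H \<longleftrightarrow> {u, v} \<in> edges G) \<and>
          (\<forall>v\<in>verts G. \<forall>u\<in>nbrs G v. f (rot G v u) = rot H (f v) (f u)))"

definition is_sum :: "'a plane_graph \<Rightarrow> 'b plane_graph \<Rightarrow> 'c plane_graph \<Rightarrow> bool" where
  "is_sum T T\<^sub>1 T\<^sub>2 \<longleftrightarrow>
     (\<exists>e\<in>edges T. plane_iso (delete_edge T e) (disjoint_sum T\<^sub>1 T\<^sub>2))"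

text \<open>
  A pr-tree, up to isomorphism, is the left-to-right list of the pr-subtrees at its root.
\<close>

datatype pr_tree = Node "pr_tree list"

datatype bracket = Opening | Closing

fun bracket_code :: "pr_tree \<Rightarrow> bracket list" where
  "bracket_code (Node ts) = Opening # concat (map bracket_code ts) @ [Closing]"

definition inversions :: "bracket list \<Rightarrow> (nat \<times> nat) set" where
  "inversions c = {(i, j). i < j \<and> j < length c \<and> c ! i = Closing \<and> c ! j = Opening}"

definition pr_even :: "pr_tree \<Rightarrow> bool" where
  "pr_even t \<longleftrightarrow> even (card (inversions (bracket_code t)))"

definition pr_odd :: "pr_tree \<Rightarrow> bool" where
  "pr_odd t \<longleftrightarrow> \<not> pr_even t"

text \<open>
  \<open>pr_branch T p v t\<close>: the part of \<open>T\<close> hanging at \<open>v\<close>, as seen from the parent \<open>p\<close> of \<open>v\<close>,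
  is the pr-tree \<open>t\<close>.  The list in the premise enumerates the neighbours of \<open>v\<close> other than
  \<open>p\<close> counterclockwise, starting just after \<open>p\<close>.
\<close>

inductive pr_branch :: "'a plane_graph \<Rightarrow> 'a \<Rightarrow> 'a \<Rightarrow> pr_tree \<Rightarrow> bool" for T where
  "list_all2 (pr_branch T v) (map (\<lambda>i. (rot T v ^^ i) p) [1..<card (nbrs T v)]) ts
     \<Longrightarrow> pr_branch T p v (Node ts)"

text \<open>
  \<open>pr_tree_of T r m t\<close>: choosing in \<open>T\<close> the root \<open>r\<close> and the marked edge \<open>{r, m}\<close> yields the
  pr-tree \<open>t\<close>.
\<close>

definition pr_tree_of :: "'a plane_graph \<Rightarrow> 'a \<Rightarrow> 'a \<Rightarrow> pr_tree \<Rightarrow> bool" where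
  "pr_tree_of T r m t \<longleftrightarrow> r \<in> verts T \<and> m \<in> nbrs T r \<and>
     (\<exists>ts. t = Node ts \<and>
        list_all2 (pr_branch T r) (map (\<lambda>i. (rot T r ^^ i) m) [0..<card (nbrs T r)]) ts)"

text \<open>
  The parity of a plane tree is meant only for an even number of vertices, in which case
  it does not depend on the choice of the root \<open>r\<close> and of the marked edge \<open>{r, m}\<close>.
\<close>

definition plane_even :: "'a plane_graph \<Rightarrow> bool" where
  "plane_even T \<longleftrightarrow> (\<exists>r m t. pr_tree_of T r m t \<and> pr_even t)"

definition plane_odd :: "'a plane_graph \<Rightarrow> bool" where
  "plane_odd T \<longleftrightarrow> (\<exists>r m t. pr_tree_of T r m t \<and> pr_odd t)"

end

theory Submission
  imports Defs
begin

text \<open>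
  The inversions of a bracket code correspond to the pairs of incomparable nodes, and the number of
  comparable pairs is the sum of all depths.  Hence, for \<open>n\<close> nodes, the number of inversions has the
  parity of \<open>n choose 2\<close> plus the number of nodes at odd depth, that is, the size of the colour class
  avoiding the root in a proper 2-colouring of the tree.  If \<open>n\<close> is even, then both colour classes
  have the same parity, so neither the root nor the embedding matters.  A 2-colouring of a sum
  restricts to 2-colourings of the summands, and \<open>(k + l) choose 2\<close> is the sum of \<open>k choose 2\<close>,
  \<open>l choose 2\<close> and the even number \<open>k * l\<close>.
\<close>

section \<open>Inversions and odd levels\<close>

lemma count_list_card: "count_list xs y = card {i. i < length xs \<and> xs ! i = y}"
  by (simp add: count_list_eq_length_filter length_filter_conv_card eq_commute)

lemma finite_inversions: "finite (inversions xs)"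
  by (rule finite_subset[of _ "{..<length xs} \<times> {..<length xs}"]) (auto simp: inversions_def)

lemma inversions_Nil: "inversions [] = {}"
  by (simp add: inversions_def)

text \<open>Position 0 can only be the left end of an inversion, paired with any later opening
  bracket; the other inversions are those of \<open>xs\<close> shifted by one.\<close>

lemma card_inversions_Cons:
  "card (inversions (x # xs)) =
     (if x = Closing then count_list xs Opening else 0) + card (inversions xs)"
proof -
  let ?J = "{j. j < length xs \<and> xs ! j = Opening \<and> x = Closing}"
  have eq: "inversions (x # xs) = (\<lambda>j. (0, Suc j)) ` ?J \<union> map_prod Suc Suc ` inversions xs"
  proof (intro set_eqI iffI)
    fix p assume "p \<in> inversions (x # xs)"
    then obtain i j where p: "p = (i, j)" "i < j" "j < Suc (length xs)"
      "(x # xs) ! i = Closing" "(x # xs) ! j = Opening"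
      by (auto simp: inversions_def)
    obtain j' where "j = Suc j'" using p(2) by (cases j) auto
    then show "p \<in> (\<lambda>j. (0, Suc j)) ` ?J \<union> map_prod Suc Suc ` inversions xs"
      using p by (cases i) (auto simp: inversions_def image_iff)
  qed (auto simp: inversions_def)
  have inj: "inj_on (map_prod Suc Suc) A" "inj_on (\<lambda>j. (0 :: nat, Suc j)) B" for A B
    by (auto simp: inj_on_def)
  have "card (inversions (x # xs)) = card ?J + card (inversions xs)"
    unfolding eq
    by (subst card_Un_disjoint)
      (auto simp: finite_inversions card_image inj)
  then show ?thesis by (auto simp: count_list_card)
qed

lemma card_inversions_append:
  "card (inversions (xs @ ys)) =
     card (inversions xs) + card (inversions ys) + count_list xs Closing * count_list ys Opening"
  by (induction xs) (auto simp: inversions_Nil card_inversions_Cons algebra_simps)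

text \<open>The number of nodes coloured \<^const>\<open>True\<close> if the levels alternate and the root is coloured \<open>b\<close>.\<close>

fun coloured_nodes :: "bool \<Rightarrow> pr_tree \<Rightarrow> nat" where
  "coloured_nodes b (Node ts) = of_bool b + sum_list (map (coloured_nodes (\<not> b)) ts)"

text \<open>Taken as the sum of the two colour classes, so that size and colour counts are linked by
  definition.\<close>

definition node_count :: "pr_tree \<Rightarrow> nat" where
  "node_count t = coloured_nodes True t + coloured_nodes False t"

lemma sum_list_node_count:
  "sum_list (map node_count ts) =
     sum_list (map (coloured_nodes True) ts) + sum_list (map (coloured_nodes False) ts)"
  by (simp add: node_count_def[abs_def] sum_list_addf)

lemma node_count_Node: "node_count (Node ts) = Suc (sum_list (map node_count ts))"
  unfolding sum_list_node_count by (simp add: node_count_def)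

text \<open>Each node contributes one bracket of each kind, so the cross term in
  \<open>card_inversions_append\<close> becomes a product of node counts.\<close>

lemma count_list_bracket_code: "count_list (bracket_code t) b = node_count t"
proof (induction t rule: bracket_code.induct)
  case (1 ts)
  then have "count_list (concat (map bracket_code ts)) b = sum_list (map node_count ts)"
    by (induction ts) auto
  then show ?case by (cases b) (auto simp: node_count_Node)
qed

text \<open>The last summand counts the pairs with one element in each part; it matches the cross
  term for inversions of a concatenation.\<close>

lemma choose_two_add: "(m + n choose 2) = (m choose 2) + (n choose 2) + m * n"
proof (induction m)
  case (Suc m)
  have "(Suc j choose 2) = (j choose 2) + j" for j
    by (simp add: numeral_2_eq_2)
  with Suc show ?case by simp
qed simp

text \<open>Concatenating codes adds the same product of node counts to the inversions and to the
  binomial, so the invariant passes to forests; adding a root exchanges the colours, which the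
  growth of the binomial compensates.\<close>

lemma even_inversions_bracket_code:
  "even (card (inversions (bracket_code t)) + coloured_nodes False t + (node_count t choose 2))"
proof (induction t rule: bracket_code.induct)
  case (1 ts)
  let ?w = "concat (map bracket_code ts)" and ?N = "sum_list (map node_count ts)"
  have forest: "even (card (inversions (concat (map bracket_code ts)))
      + sum_list (map (coloured_nodes False) ts) + (sum_list (map node_count ts) choose 2))
      \<and> count_list (concat (map bracket_code ts)) Opening = sum_list (map node_count ts)"
    using 1
  proof (induction ts)
    case (Cons t ts)
    then show ?case
      by (auto simp: card_inversions_append choose_two_add count_list_bracket_code)
  qed (simp add: inversions_Nil numeral_2_eq_2)
  \<comment> \<open>The outer brackets come first and last, so they lie in no inversion.\<close>
  have inv: "card (inversions (bracket_code (Node ts))) = card (inversions ?w)"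
    by (simp add: card_inversions_Cons card_inversions_append inversions_Nil)
  \<comment> \<open>The \<open>False\<close> nodes of the tree are the \<open>True\<close> nodes of
    the forest. Modulo 2, adding \<open>?N\<close>, the total of both colours, turns their number
    into that of the \<open>False\<close> nodes of the forest.\<close>
  have "(node_count (Node ts) choose 2) = (?N choose 2) + ?N"
    using choose_two_add[of 1 ?N] by (simp add: node_count_Node)
  then show ?case using forest unfolding inv by (auto simp: sum_list_node_count)
qed

section \<open>Branches of a tree\<close>

lemma plane_treeD:
  assumes "plane_tree T"
  shows "finite (verts T)" "verts T \<noteq> {}" "connected_graph T" "\<not> is_cycle T c"
    "{a, b} \<in> edges T \<Longrightarrow> a \<in> verts T \<and> b \<in> verts T \<and> a \<noteq> b"
    "v \<in> verts T \<Longrightarrow> u \<in> nbrs T v \<Longrightarrow> cyclic_on (rot T v) (nbrs T v)"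
  using assms unfolding plane_tree_def by (fastforce dest!: bspec[of _ _ "{a, b}"])+

lemma finite_edges: "plane_tree T \<Longrightarrow> finite (edges T)"
  unfolding plane_tree_def by (rule finite_subset[of _ "Pow (verts T)"]) auto

text \<open>Loop erasure: when a step returns to a vertex already visited, the path is cut back to
  that vertex.\<close>

lemma rtrancl_distinct_path:
  assumes "(x, y) \<in> R\<^sup>*"
  shows "\<exists>xs. xs \<noteq> [] \<and> hd xs = x \<and> last xs = y \<and> distinct xs \<and>
    successively (\<lambda>a b. (a, b) \<in> R) xs"
  using assms
proof induction
  case base
  show ?case by (rule exI[of _ "[x]"]) simp
next
  case (step y z)
  then obtain xs where xs: "xs \<noteq> []" "hd xs = x" "last xs = y" "distinct xs"
    "successively (\<lambda>a b. (a, b) \<in> R) xs" by blast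
  show ?case
  proof (cases "z \<in> set xs")
    case True
    then obtain ys zs where "xs = ys @ z # zs" by (auto dest: split_list)
    with xs show ?thesis
      by (intro exI[of _ "ys @ [z]"]) (auto simp: successively_append_iff hd_append split: if_splits)
  next
    case False
    with xs step show ?thesis
      by (intro exI[of _ "xs @ [z]"]) (auto simp: successively_append_iff)
  qed
qed

lemma is_cycleI:
  assumes "distinct xs" "length xs \<ge> 3" "successively (\<lambda>a b. {a, b} \<in> edges G) xs"
    "{last xs, hd xs} \<in> edges G"
  shows "is_cycle G xs"
  unfolding is_cycle_def
proof (intro conjI allI impI)
  fix i assume i: "i < length xs"
  show "{xs ! i, xs ! (Suc i mod length xs)} \<in> edges G"
  proof (cases "Suc i = length xs")
    case True
    then have "xs ! i = last xs" "xs ! 0 = hd xs"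
      using i True last_conv_nth[of xs] hd_conv_nth[of xs] by (cases xs; force)+
    with True show ?thesis using assms(4) by simp
  next
    case False
    with i assms(3) show ?thesis by (auto simp: successively_conv_nth)
  qed
qed (use assms in auto)

definition steps_avoiding :: "'a plane_graph \<Rightarrow> 'a \<Rightarrow> ('a \<times> 'a) set" where
  "steps_avoiding G p = {(a, b). {a, b} \<in> edges G \<and> a \<noteq> p \<and> b \<noteq> p}"

text \<open>For a neighbour \<open>v\<close> of \<open>p\<close> in a tree this is the component of
  \<open>v\<close> after removal of the vertex \<open>p\<close>, that is, the vertex set of the part
  described by \<open>pr_branch\<close>.\<close>

definition branch_verts :: "'a plane_graph \<Rightarrow> 'a \<Rightarrow> 'a \<Rightarrow> 'a set" where
  "branch_verts G p v = {x. (v, x) \<in> (steps_avoiding G p)\<^sup>*}"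

lemma root_in_branch_verts: "v \<in> branch_verts G p v"
  by (simp add: branch_verts_def)

lemma branch_verts_step:
  "a \<in> branch_verts G p v \<Longrightarrow> {a, b} \<in> edges G \<Longrightarrow> a \<noteq> p \<Longrightarrow> b \<noteq> p \<Longrightarrow> b \<in> branch_verts G p v"
  unfolding branch_verts_def steps_avoiding_def by (auto intro: rtrancl_into_rtrancl)

lemma parent_notin_branch_verts: "v \<noteq> p \<Longrightarrow> p \<notin> branch_verts G p v"
  unfolding branch_verts_def by (auto elim: rtranclE simp: steps_avoiding_def)

lemma sym_steps_avoiding: "sym (steps_avoiding G p)"
  by (auto simp: sym_def steps_avoiding_def insert_commute)

lemma branch_verts_eq: "x \<in> branch_verts G p v \<Longrightarrow> branch_verts G p x = branch_verts G p v"
  unfolding branch_verts_def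
  using symD[OF sym_rtrancl[OF sym_steps_avoiding[of G p]], of v x] by (auto intro: rtrancl_trans)

lemma branch_verts_subset: "plane_tree T \<Longrightarrow> v \<in> verts T \<Longrightarrow> branch_verts T p v \<subseteq> verts T"
proof
  fix x assume "plane_tree T" "v \<in> verts T" "x \<in> branch_verts T p v"
  from this(3) show "x \<in> verts T" unfolding branch_verts_def mem_Collect_eq
    by induction (use \<open>v \<in> verts T\<close> plane_treeD(5)[OF \<open>plane_tree T\<close>]
        in \<open>auto simp: steps_avoiding_def\<close>)
qed

context
  fixes T :: "'a plane_graph"
  assumes T: "plane_tree T"
begin

section \<open>Decomposition of a tree into branches\<close>

lemma nbrs_verts: "v \<in> nbrs T u \<Longrightarrow> u \<in> verts T \<and> v \<in> verts T \<and> v \<noteq> u \<and> u \<in> nbrs T v"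
  using plane_treeD(5)[OF T, of u v] by (auto simp: nbrs_def insert_commute)

text \<open>Acyclicity enters here: a simple path from \<open>w\<close> to \<open>w'\<close>
  avoiding \<open>v\<close> would close up through \<open>v\<close> to a cycle.\<close>

lemma nbr_notin_branch_verts:
  assumes w: "w \<in> nbrs T v" and w': "w' \<in> nbrs T v" and "w \<noteq> w'"
  shows "w' \<notin> branch_verts T v w"
proof
  assume "w' \<in> branch_verts T v w"
  then obtain xs where xs: "xs \<noteq> []" "hd xs = w" "last xs = w'" "distinct xs"
    "successively (\<lambda>a b. (a, b) \<in> steps_avoiding T v) xs"
    by (auto simp: branch_verts_def dest!: rtrancl_distinct_path)
  have "v \<notin> set xs"
  proof
    assume "v \<in> set xs"
    then obtain ys zs where "xs = ys @ v # zs" by (auto dest: split_list)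
    with xs show False
      using nbrs_verts[OF w]
      by (cases ys rule: rev_cases) (auto simp: successively_append_iff steps_avoiding_def)
  qed
  moreover have "length xs \<ge> 2"
    using xs \<open>w \<noteq> w'\<close> by (cases xs) (auto simp: Suc_le_eq)
  moreover have "successively (\<lambda>a b. {a, b} \<in> edges T) xs"
    using xs(5) by (rule successively_mono) (auto simp: steps_avoiding_def)
  ultimately have "is_cycle T (v # xs)"
    using xs w w' by (intro is_cycleI) (auto simp: successively_Cons nbrs_def insert_commute)
  then show False using plane_treeD(4)[OF T] by blast
qed

lemma branch_verts_disjoint:
  assumes "w \<in> nbrs T v" "w' \<in> nbrs T v" "w \<noteq> w'"
  shows "branch_verts T v w \<inter> branch_verts T v w' = {}"
proof (rule ccontr)
  assume "\<not> ?thesis"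
  then obtain x where "x \<in> branch_verts T v w" "x \<in> branch_verts T v w'" by blast
  then have "branch_verts T v w = branch_verts T v w'" by (metis branch_verts_eq)
  then show False using nbr_notin_branch_verts[OF assms] root_in_branch_verts by metis
qed

text \<open>The counterpart for vertex sets of the recursion in \<open>pr_branch\<close>. A walk
  avoiding \<open>p\<close> enters the branch of a child whenever it leaves \<open>v\<close>;
  conversely, a walk inside such a branch never meets \<open>p\<close>, because \<open>p\<close> is
  another neighbour of \<open>v\<close>.\<close>

lemma branch_verts_unfold:
  assumes v: "v \<in> nbrs T p"
  shows "branch_verts T p v = insert v (\<Union>w \<in> nbrs T v - {p}. branch_verts T v w)" (is "_ = ?R")
proof
  show "branch_verts T p v \<subseteq> ?R"
  proof
    fix x assume "x \<in> branch_verts T p v"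
    then have "(v, x) \<in> (steps_avoiding T p)\<^sup>*" by (simp add: branch_verts_def)
    then show "x \<in> ?R"
    proof induction
      case (step x y)
      then have xy: "{x, y} \<in> edges T" "y \<noteq> p" by (auto simp: steps_avoiding_def)
      show ?case
      proof (cases "y = v")
        case False
        show ?thesis
        proof (cases "x = v")
          case True
          with xy show ?thesis
            by (intro insertI2 UN_I[of y]) (auto simp: nbrs_def root_in_branch_verts)
        next
          case neq: False
          with step.IH obtain w where "w \<in> nbrs T v - {p}" "x \<in> branch_verts T v w" by auto
          with xy False neq show ?thesis by (auto intro: branch_verts_step)
        qed
      qed simp
    qed simp
  qed
next
  have "x \<in> branch_verts T p v" if w: "w \<in> nbrs T v" "w \<noteq> p" and x: "x \<in> branch_verts T v w" for w x
  proof -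
    have p: "p \<in> nbrs T v" using nbrs_verts[OF v] by simp
    have notp: "y \<noteq> p" if "y \<in> branch_verts T v w" for y
      using nbr_notin_branch_verts[OF w(1) p w(2)] that by blast
    from x have "(w, x) \<in> (steps_avoiding T v)\<^sup>*" by (simp add: branch_verts_def)
    then show ?thesis
    proof induction
      case base
      then show ?case
        using w nbrs_verts[OF v] branch_verts_step[OF root_in_branch_verts, of v w T p]
        by (auto simp: nbrs_def)
    next
      case (step y z)
      have "y \<noteq> p" using step notp by (simp add: branch_verts_def)
      moreover have "z \<noteq> p"
        using step notp[of z] by (auto simp: branch_verts_def intro: rtrancl_into_rtrancl)
      ultimately show ?case using step by (auto simp: steps_avoiding_def intro: branch_verts_step)
    qed
  qed
  then show "?R \<subseteq> branch_verts T p v" using root_in_branch_verts by fast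
qed

text \<open>By connectedness every vertex is reached by a walk from \<open>r\<close>, and a walk
  changes branches only by passing through \<open>r\<close>.\<close>

lemma verts_unfold:
  assumes r: "r \<in> verts T"
  shows "verts T = insert r (\<Union>w \<in> nbrs T r. branch_verts T r w)" (is "_ = ?R")
proof
  show "verts T \<subseteq> ?R"
  proof
    fix x assume "x \<in> verts T"
    with r plane_treeD(3)[OF T] have "(r, x) \<in> {(x, y). {x, y} \<in> edges T}\<^sup>*"
      by (auto simp: connected_graph_def)
    then show "x \<in> ?R"
    proof induction
      case (step x y)
      then have xy: "{x, y} \<in> edges T" by auto
      show ?case
      proof (cases "x = r \<or> y = r")
        case True
        with xy show ?thesis
          by (cases "y = r") (auto simp: nbrs_def intro!: bexI[of _ y] root_in_branch_verts)
      next
        case False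
        with step.IH xy show ?thesis by (auto intro: branch_verts_step)
      qed
    qed simp
  qed
  show "?R \<subseteq> verts T" using r branch_verts_subset[OF T] nbrs_verts by blast
qed

lemma nbrs_enumeration:
  assumes m: "m \<in> nbrs T v"
  defines "ws \<equiv> map (\<lambda>i. (rot T v ^^ i) m) [0..<card (nbrs T v)]"
  shows "ws = m # map (\<lambda>i. (rot T v ^^ i) m) [1..<card (nbrs T v)]"
    and "distinct ws" and "set ws = nbrs T v"
proof -
  have "cyclic_on (rot T v) (nbrs T v)"
    using plane_treeD(6)[OF T _ m] nbrs_verts[OF m] by blast
  then have orb: "orbit (rot T v) m = nbrs T v" by (rule orbit_cyclic_eq3[OF _ m])
  \<comment> \<open>\<open>n\<close> is the first return time to \<open>m\<close>; the iterates
    below it are distinct and fill the orbit, so \<open>n\<close> is the degree of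
    \<open>v\<close>.\<close>
  define n where "n = funpow_dist1 (rot T v) m m"
  have inj: "inj_on (\<lambda>i. (rot T v ^^ i) m) {0..<n}"
    unfolding n_def using m by (intro inj_on_funpow_dist1) (simp add: orb)
  have img: "nbrs T v = (\<lambda>i. (rot T v ^^ i) m) ` {0..<n}"
    unfolding n_def using orbit_conv_funpow_dist1[of m "rot T v"] m by (simp add: orb)
  then have card: "card (nbrs T v) = n" using card_image[OF inj] by simp
  show "distinct ws" using inj by (simp add: ws_def card distinct_map)
  show "set ws = nbrs T v" unfolding ws_def card by (simp add: img)
  have "n > 0" by (simp add: n_def)
  then show "ws = m # map (\<lambda>i. (rot T v ^^ i) m) [1..<card (nbrs T v)]"
    unfolding ws_def card by (simp add: upt_conv_Cons)
qed

text \<open>Index 0 of the enumeration from \<open>p\<close> is the parent itself, hence the start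
  at 1 here and in \<open>pr_branch\<close>.\<close>

lemma children_enumeration:
  assumes "v \<in> nbrs T p"
  defines "ws \<equiv> map (\<lambda>i. (rot T v ^^ i) p) [1..<card (nbrs T v)]"
  shows "distinct ws" and "set ws = nbrs T v - {p}"
proof -
  have "p \<in> nbrs T v" using nbrs_verts assms(1) by blast
  note enum = nbrs_enumeration[OF this, folded ws_def]
  from enum(2,3) show "distinct ws" and "set ws = nbrs T v - {p}"
    unfolding enum(1) by auto
qed

text \<open>The recursion in \<open>pr_branch\<close> terminates: the branch of a child lies inside
  that of \<open>v\<close> and lacks \<open>v\<close>.\<close>

lemma pr_branch_exists: "v \<in> nbrs T p \<Longrightarrow> \<exists>t. pr_branch T p v t"
proof (induction "card (branch_verts T p v)" arbitrary: p v rule: less_induct)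
  case less
  let ?ws = "map (\<lambda>i. (rot T v ^^ i) p) [1..<card (nbrs T v)]"
  have "\<exists>t. pr_branch T v w t" if w: "w \<in> set ?ws" for w
  proof (rule less.hyps)
    from w children_enumeration(2)[OF less.prems] have w': "w \<in> nbrs T v - {p}" by simp
    then show "w \<in> nbrs T v" by simp
    have "v \<notin> branch_verts T v w"
      using w' nbrs_verts[of w v] by (intro parent_notin_branch_verts) auto
    moreover have "branch_verts T v w \<subseteq> branch_verts T p v"
      using w' branch_verts_unfold[OF less.prems] by auto
    ultimately have "branch_verts T v w \<subset> branch_verts T p v"
      using root_in_branch_verts by fast
    moreover have "finite (branch_verts T p v)"
      using branch_verts_subset[OF T] nbrs_verts[OF less.prems] plane_treeD(1)[OF T]
      by (blast intro: finite_subset)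
    ultimately show "card (branch_verts T v w) < card (branch_verts T p v)"
      by (rule psubset_card_mono[rotated])
  qed
  then obtain f where "\<forall>w \<in> set ?ws. pr_branch T v w (f w)" by metis
  then have "list_all2 (pr_branch T v) ?ws (map f ?ws)"
    by (simp only: list_all2_map2 list_all2_same)
  then show ?case by (blast intro: pr_branch.intros)
qed

lemma pr_tree_of_exists:
  assumes m: "m \<in> nbrs T r"
  shows "\<exists>t. pr_tree_of T r m t"
proof -
  let ?ws = "map (\<lambda>i. (rot T r ^^ i) m) [0..<card (nbrs T r)]"
  have "\<forall>w \<in> set ?ws. \<exists>t. pr_branch T r w t"
    using nbrs_enumeration(3)[OF m] pr_branch_exists by blast
  then obtain f where "\<forall>w \<in> set ?ws. pr_branch T r w (f w)" by metis
  then have "list_all2 (pr_branch T r) ?ws (map f ?ws)"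
    by (simp only: list_all2_map2 list_all2_same)
  then show ?thesis using m nbrs_verts[OF m] unfolding pr_tree_of_def by blast
qed

end

section \<open>Proper 2-colourings\<close>

definition two_colouring :: "'a plane_graph \<Rightarrow> ('a \<Rightarrow> bool) \<Rightarrow> bool" where
  "two_colouring G \<chi> \<longleftrightarrow> (\<forall>a b. {a, b} \<in> edges G \<longrightarrow> \<chi> a \<noteq> \<chi> b)"

lemma two_colouring_Not: "two_colouring G \<chi> \<Longrightarrow> two_colouring G (\<lambda>x. \<not> \<chi> x)"
  by (simp add: two_colouring_def)

section \<open>Existence of a proper 2-colouring\<close>

lemma is_cycle_delete_edge: "is_cycle (delete_edge G e) c \<Longrightarrow> is_cycle G c"
  by (auto simp: is_cycle_def delete_edge_def)

text \<open>Delete an edge, colour the rest by induction, and flip the component of one end if both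
  ends received the same colour. Acyclicity puts the ends into different components.\<close>

lemma two_colouring_exists:
  assumes "finite (edges G)" "\<And>e. e \<in> edges G \<Longrightarrow> card e = 2" "\<nexists>c. is_cycle G c"
  shows "\<exists>\<chi>. two_colouring G \<chi>"
  using assms
proof (induction "card (edges G)" arbitrary: G)
  case 0
  then show ?case by (simp add: two_colouring_def)
next
  case (Suc n)
  then obtain e where e: "e \<in> edges G" by fastforce
  with Suc.prems obtain u v where uv: "e = {u, v}" "u \<noteq> v" by (metis card_2_iff)
  let ?H = "delete_edge G e"
  have edges: "edges ?H = edges G - {e}" by (simp add: delete_edge_def)
  have "\<exists>\<chi>. two_colouring ?H \<chi>"
    using Suc e is_cycle_delete_edge[of G e] by (intro Suc.hyps(1)) (auto simp: edges)
  then obtain \<chi> where \<chi>: "two_colouring ?H \<chi>" ..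
  define R where "R = {(a, b). {a, b} \<in> edges ?H}"
  have sym: "(a, b) \<in> R \<longleftrightarrow> (b, a) \<in> R" for a b by (simp add: R_def insert_commute)
  have "(v, u) \<notin> R\<^sup>*"
  proof
    assume "(v, u) \<in> R\<^sup>*"
    then obtain xs where xs: "xs \<noteq> []" "hd xs = v" "last xs = u" "distinct xs"
      "successively (\<lambda>a b. (a, b) \<in> R) xs"
      by (auto dest!: rtrancl_distinct_path)
    \<comment> \<open>One vertex would force \<open>u = v\<close>, and two would require the deleted
      edge.\<close>
    have "length xs \<ge> 3"
    proof (rule ccontr)
      assume "\<not> length xs \<ge> 3"
      then consider "length xs = 0" | "length xs = 1" | "length xs = 2" by linarith
      then show False
        using xs uv by cases (auto simp: length_Suc_conv numeral_2_eq_2 R_def delete_edge_def insert_commute)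
    qed
    moreover have "successively (\<lambda>a b. {a, b} \<in> edges G) xs"
      using xs(5) by (rule successively_mono) (auto simp: R_def edges)
    ultimately have "is_cycle G xs" using xs e uv by (intro is_cycleI) auto
    with Suc.prems show False by blast
  qed
  \<comment> \<open>The ends of a remaining edge lie in the same component, so they are flipped
    together or not at all.\<close>
  moreover have "(v, a) \<in> R\<^sup>* \<longleftrightarrow> (v, b) \<in> R\<^sup>*" if "(a, b) \<in> R" for a b
    using that sym by (meson rtrancl_into_rtrancl)
  moreover have "(a, b) \<in> R \<or> {a, b} = {u, v}" if "{a, b} \<in> edges G" for a b
    using that by (simp add: R_def edges flip: uv(1))
  moreover have "\<chi> a \<noteq> \<chi> b" if "(a, b) \<in> R" for a b
    using \<chi> that by (auto simp: two_colouring_def R_def)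
  \<comment> \<open>Inequality of truth values acts as exclusive or: the colour flips exactly on the
    component of \<open>v\<close>, and only if \<open>u\<close> and \<open>v\<close> clash.\<close>
  ultimately have "two_colouring G (\<lambda>x. \<chi> x \<noteq> ((v, x) \<in> R\<^sup>* \<and> \<chi> u = \<chi> v))"
    unfolding two_colouring_def by (metis doubleton_eq_iff rtrancl.rtrancl_refl)
  then show ?case by blast
qed

lemma card_forest:
  assumes "list_all2 (\<lambda>w t. card {x \<in> B w. \<chi> x} = g t) ws ts" "distinct ws"
    and "\<And>w. w \<in> set ws \<Longrightarrow> finite (B w)"
    and "\<And>w w'. w \<in> set ws \<Longrightarrow> w' \<in> set ws \<Longrightarrow> w \<noteq> w' \<Longrightarrow> B w \<inter> B w' = {}"
  shows "card {x \<in> \<Union> (B ` set ws). \<chi> x} = sum_list (map g ts)"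
  using assms
proof (induction rule: list_all2_induct)
  case (Cons w ws t ts)
  have disj: "{x \<in> B w. \<chi> x} \<inter> {x \<in> \<Union> (B ` set ws). \<chi> x} = {}"
  proof -
    have "B w \<inter> B w' = {}" if "w' \<in> set ws" for w'
      using Cons.prems(1) that by (intro Cons.prems(3)) auto
    then show ?thesis by blast
  qed
  have "{x \<in> \<Union> (B ` set (w # ws)). \<chi> x} = {x \<in> B w. \<chi> x} \<union> {x \<in> \<Union> (B ` set ws). \<chi> x}" by auto
  then have "card {x \<in> \<Union> (B ` set (w # ws)). \<chi> x} =
      card {x \<in> B w. \<chi> x} + card {x \<in> \<Union> (B ` set ws). \<chi> x}"
    using Cons.prems(2) by (simp only:) (rule card_Un_disjoint[OF _ _ disj]; simp)
  moreover have "card {x \<in> \<Union> (B ` set ws). \<chi> x} = sum_list (map g ts)"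
    using Cons.prems by (intro Cons.IH) auto
  ultimately show ?case using Cons.hyps(1) by simp
qed simp

lemma card_insert_root:
  assumes "v \<notin> A" "finite A"
  shows "card {x \<in> insert v A. \<chi> x} = of_bool (\<chi> v) + card {x \<in> A. \<chi> x}"
proof -
  have "{x \<in> insert v A. \<chi> x} = (if \<chi> v then insert v {x \<in> A. \<chi> x} else {x \<in> A. \<chi> x})" by auto
  with assms show ?thesis by simp
qed

context
  fixes T :: "'a plane_graph" and \<chi> :: "'a \<Rightarrow> bool"
  assumes T: "plane_tree T" and \<chi>: "two_colouring T \<chi>"
begin

section \<open>Colour counts of branches and of the whole tree\<close>

lemma finite_branch_verts: "v \<in> nbrs T p \<Longrightarrow> finite (branch_verts T p v)"
  by (rule finite_subset[OF branch_verts_subset[OF T] plane_treeD(1)[OF T]])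
    (simp add: nbrs_verts[OF T])

text \<open>Common step for the root and the other vertices: \<open>ws\<close> will be all
  neighbours of \<open>v\<close>, or all but its parent. Neighbours of \<open>v\<close> have the
  opposite colour, as in the recursion of \<open>coloured_nodes\<close>.\<close>

lemma card_coloured_at:
  assumes "list_all2 (\<lambda>w t. card {x \<in> branch_verts T v w. \<chi> x} = coloured_nodes (\<chi> w) t) ws ts"
    and "distinct ws" "set ws \<subseteq> nbrs T v"
  shows "card {x \<in> insert v (\<Union> (branch_verts T v ` set ws)). \<chi> x} = coloured_nodes (\<chi> v) (Node ts)"
proof -
  have w: "w \<in> nbrs T v" "\<chi> w \<longleftrightarrow> \<not> \<chi> v" if "w \<in> set ws" for w
    using that assms(3) \<chi> by (auto simp: two_colouring_def nbrs_def)
  have forest: "list_all2 (\<lambda>w t. card {x \<in> branch_verts T v w. \<chi> x} =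
      coloured_nodes (\<not> \<chi> v) t) ws ts"
    using assms(1) w by (auto simp: list_all2_conv_all_nth)
  have "v \<notin> branch_verts T v w" if "w \<in> set ws" for w
    using nbrs_verts[OF T w(1)[OF that]] by (intro parent_notin_branch_verts) auto
  then have notin: "v \<notin> \<Union> (branch_verts T v ` set ws)" by blast
  have fin: "finite (\<Union> (branch_verts T v ` set ws))" using w(1) finite_branch_verts by blast
  have "card {x \<in> \<Union> (branch_verts T v ` set ws). \<chi> x} =
      sum_list (map (coloured_nodes (\<not> \<chi> v)) ts)"
    using forest assms(2)
    by (rule card_forest) (use w(1) finite_branch_verts branch_verts_disjoint[OF T] in blast)+
  with card_insert_root[OF notin fin, of \<chi>] show ?thesis by simp
qed

lemma card_coloured_branch:
  assumes "pr_branch T p v t" "v \<in> nbrs T p"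
  shows "card {x \<in> branch_verts T p v. \<chi> x} = coloured_nodes (\<chi> v) t"
  using assms
proof (induction rule: pr_branch.induct)
  case (1 v p ts)
  note enum = children_enumeration[OF T 1(2)]
  have "list_all2 (\<lambda>w t. card {x \<in> branch_verts T v w. \<chi> x} = coloured_nodes (\<chi> w) t)
      (map (\<lambda>i. (rot T v ^^ i) p) [1..<card (nbrs T v)]) ts"
    using 1(1) by (rule list.rel_mono_strong) (use enum(2) in blast)
  from card_coloured_at[OF this enum(1)] show ?case
    unfolding enum(2) branch_verts_unfold[OF T 1(2)] by simp
qed

text \<open>The source of the independence of root and marked edge: neither occurs on the left, and
  on the right \<open>r\<close> matters beyond \<open>t\<close> only through its colour.\<close>

lemma card_coloured_tree:
  assumes "pr_tree_of T r m t"
  shows "card {x \<in> verts T. \<chi> x} = coloured_nodes (\<chi> r) t"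
proof -
  from assms obtain ts where t: "t = Node ts" and r: "r \<in> verts T" and m: "m \<in> nbrs T r"
    and ts: "list_all2 (pr_branch T r) (map (\<lambda>i. (rot T r ^^ i) m) [0..<card (nbrs T r)]) ts"
    by (auto simp: pr_tree_of_def)
  note enum = nbrs_enumeration[OF T m]
  have "list_all2 (\<lambda>w t. card {x \<in> branch_verts T r w. \<chi> x} = coloured_nodes (\<chi> w) t)
      (map (\<lambda>i. (rot T r ^^ i) m) [0..<card (nbrs T r)]) ts"
    using ts by (rule list.rel_mono_strong) (use enum(3) card_coloured_branch in blast)
  from card_coloured_at[OF this enum(2)] show ?thesis
    unfolding enum(3) t verts_unfold[OF T r] by simp
qed

end

section \<open>Parity of plane trees\<close>

lemma card_split: "finite A \<Longrightarrow> card A = card {x \<in> A. P x} + card {x \<in> A. \<not> P x}"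
  by (subst card_Un_disjoint[symmetric]) (auto intro: arg_cong[where f = card])

text \<open>The two colour classes have an even total, so their sizes agree modulo 2, and the class
  avoiding the root may be replaced by the class of \<open>\<chi>\<close>.\<close>

lemma pr_even_iff_colouring:
  assumes T: "plane_tree T" and \<chi>: "two_colouring T \<chi>" and even: "even (card (verts T))"
    and t: "pr_tree_of T r m t"
  shows "pr_even t \<longleftrightarrow> even ((card (verts T) choose 2) + card {x \<in> verts T. \<chi> x})"
proof -
  have c: "card {x \<in> verts T. \<chi> x} = coloured_nodes (\<chi> r) t"
    by (rule card_coloured_tree[OF T \<chi> t])
  \<comment> \<open>The complementary colouring counts the other class; together the two counts show
    that \<open>t\<close> has one node per vertex.\<close>
  have d: "card {x \<in> verts T. \<not> \<chi> x} = coloured_nodes (\<not> \<chi> r) t"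
    using card_coloured_tree[OF T two_colouring_Not[OF \<chi>] t] by simp
  have n: "card (verts T) = node_count t"
    using card_split[OF plane_treeD(1)[OF T], of \<chi>] unfolding c d
    by (cases "\<chi> r") (auto simp: node_count_def)
  then have "even (coloured_nodes True t) \<longleftrightarrow> even (coloured_nodes False t)"
    using even by (auto simp: node_count_def)
  then have "even (card {x \<in> verts T. \<chi> x}) \<longleftrightarrow> even (coloured_nodes False t)"
    unfolding c by (cases "\<chi> r") auto
  then show ?thesis
    using even_inversions_bracket_code[of t] unfolding pr_even_def n by auto
qed

text \<open>An even number of vertices rules out the one-vertex tree, which has no edge to
  mark.\<close>

lemma pr_tree_of_exists_even:
  assumes T: "plane_tree T" and even: "even (card (verts T))"
  shows "\<exists>r m t. pr_tree_of T r m t"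
proof -
  obtain r where r: "r \<in> verts T" using plane_treeD(2)[OF T] by blast
  have "nbrs T r \<noteq> {}"
  proof
    assume "nbrs T r = {}"
    then have "verts T = {r}" using verts_unfold[OF T r] by simp
    with even show False by simp
  qed
  then show ?thesis using pr_tree_of_exists[OF T] by blast
qed

text \<open>All choices of root and marked edge give the same parity and at least one choice exists,
  so the existential definitions are decided by any one colouring.\<close>

lemma plane_parity_iff_colouring:
  assumes "plane_tree T" "two_colouring T \<chi>" "even (card (verts T))"
  shows "plane_even T \<longleftrightarrow> even ((card (verts T) choose 2) + card {x \<in> verts T. \<chi> x})"
    and "plane_odd T \<longleftrightarrow> odd ((card (verts T) choose 2) + card {x \<in> verts T. \<chi> x})"
  using pr_even_iff_colouring[OF assms] pr_tree_of_exists_even[OF assms(1,3)]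
  unfolding plane_even_def plane_odd_def pr_odd_def by blast+

text \<open>The colouring is pulled back along the inverse of the isomorphism, which maps edges of
  the summands to edges of \<open>T\<close> other than \<open>e\<close>.\<close>

lemma plane_iso_sum_colouring:
  assumes iso: "plane_iso (delete_edge T e) (disjoint_sum T\<^sub>1 T\<^sub>2)"
    and T1: "plane_tree T\<^sub>1" and T2: "plane_tree T\<^sub>2" and \<chi>: "two_colouring T \<chi>"
  obtains \<chi>\<^sub>1 \<chi>\<^sub>2 where "two_colouring T\<^sub>1 \<chi>\<^sub>1" "two_colouring T\<^sub>2 \<chi>\<^sub>2"
    "card {x \<in> verts T. \<chi> x} = card {x \<in> verts T\<^sub>1. \<chi>\<^sub>1 x} + card {x \<in> verts T\<^sub>2. \<chi>\<^sub>2 x}"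
    "card (verts T) = card (verts T\<^sub>1) + card (verts T\<^sub>2)"
proof -
  obtain f where f: "bij_betw f (verts T) (verts T\<^sub>1 <+> verts T\<^sub>2)"
    and adj: "\<And>u v. u \<in> verts T \<Longrightarrow> v \<in> verts T \<Longrightarrow>
      {f u, f v} \<in> edges (disjoint_sum T\<^sub>1 T\<^sub>2) \<longleftrightarrow> {u, v} \<in> edges T - {e}"
    using iso unfolding plane_iso_def by (auto simp: delete_edge_def disjoint_sum_def)
  define g where "g = inv_into (verts T) f"
  have g: "bij_betw g (verts T\<^sub>1 <+> verts T\<^sub>2) (verts T)"
    unfolding g_def by (rule bij_betw_inv_into[OF f])
  have fg: "f (g y) = y" "g y \<in> verts T" if "y \<in> verts T\<^sub>1 <+> verts T\<^sub>2" for y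
    using that bij_betw_inv_into_right[OF f that] bij_betwE[OF g] by (auto simp: g_def)
  have col: "\<chi> (g a) \<noteq> \<chi> (g b)"
    if "{a, b} \<in> edges (disjoint_sum T\<^sub>1 T\<^sub>2)" "a \<in> verts T\<^sub>1 <+> verts T\<^sub>2" "b \<in> verts T\<^sub>1 <+> verts T\<^sub>2"
    for a b
    using that adj[of "g a" "g b"] fg \<chi> by (auto simp: two_colouring_def)
  have 1: "two_colouring T\<^sub>1 (\<lambda>x. \<chi> (g (Inl x)))" unfolding two_colouring_def
  proof (intro allI impI)
    fix a b assume ab: "{a, b} \<in> edges T\<^sub>1"
    then have "Inl ` {a, b} \<in> edges (disjoint_sum T\<^sub>1 T\<^sub>2)" by (auto simp: disjoint_sum_def simp del: image_insert)
    with ab show "\<chi> (g (Inl a)) \<noteq> \<chi> (g (Inl b))"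
      using plane_treeD(5)[OF T1 ab] by (intro col) auto
  qed
  have 2: "two_colouring T\<^sub>2 (\<lambda>x. \<chi> (g (Inr x)))" unfolding two_colouring_def
  proof (intro allI impI)
    fix a b assume ab: "{a, b} \<in> edges T\<^sub>2"
    then have "Inr ` {a, b} \<in> edges (disjoint_sum T\<^sub>1 T\<^sub>2)" by (auto simp: disjoint_sum_def simp del: image_insert)
    with ab show "\<chi> (g (Inr a)) \<noteq> \<chi> (g (Inr b))"
      using plane_treeD(5)[OF T2 ab] by (intro col) auto
  qed
  have fin: "finite (verts T\<^sub>1)" "finite (verts T\<^sub>2)" using plane_treeD(1) T1 T2 by auto
  let ?A = "{x \<in> verts T\<^sub>1. \<chi> (g (Inl x))}" and ?B = "{x \<in> verts T\<^sub>2. \<chi> (g (Inr x))}"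
  have "{x \<in> verts T. \<chi> x} = g ` (?A <+> ?B)"
    using bij_betw_imp_surj_on[OF g] by auto
  moreover have "inj_on g (?A <+> ?B)"
    using bij_betw_imp_inj_on[OF g] by (rule inj_on_subset) auto
  ultimately have "card {x \<in> verts T. \<chi> x} = card ?A + card ?B"
    using fin by (simp add: card_image card_Plus)
  moreover have "card (verts T) = card (verts T\<^sub>1) + card (verts T\<^sub>2)"
    using bij_betw_same_card[OF f] fin by (simp add: card_Plus)
  ultimately show ?thesis using that[OF 1 2] by blast
qed

theorem proposition4p1:
  fixes T :: "'a plane_graph" and T\<^sub>1 :: "'b plane_graph" and T\<^sub>2 :: "'c plane_graph"
    and k l :: nat
  assumes "plane_tree T\<^sub>1" and "card (verts T\<^sub>1) = k" and "even k"
    and "plane_tree T\<^sub>2" and "card (verts T\<^sub>2) = l" and "even l"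
    and "plane_tree T" and "is_sum T T\<^sub>1 T\<^sub>2"
  shows "plane_odd T \<longleftrightarrow>
    (plane_odd T\<^sub>1 \<and> plane_even T\<^sub>2) \<or> (plane_even T\<^sub>1 \<and> plane_odd T\<^sub>2)"
proof -
  from assms(8) obtain e where iso: "plane_iso (delete_edge T e) (disjoint_sum T\<^sub>1 T\<^sub>2)"
    unfolding is_sum_def by blast
  \<comment> \<open>One colouring of \<open>T\<close> is fixed; it and its restrictions to the
    summands compute all three parities.\<close>
  obtain \<chi> where \<chi>: "two_colouring T \<chi>"
  proof -
    have "card e = 2" if "e \<in> edges T" for e
      using assms(7) that unfolding plane_tree_def by blast
    moreover have "\<nexists>c. is_cycle T c" using plane_treeD(4)[OF assms(7)] by blast
    ultimately show ?thesis
      using two_colouring_exists[OF finite_edges[OF assms(7)]] that by blast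
  qed
  obtain \<chi>\<^sub>1 \<chi>\<^sub>2 where \<chi>12: "two_colouring T\<^sub>1 \<chi>\<^sub>1" "two_colouring T\<^sub>2 \<chi>\<^sub>2"
    and split: "card {x \<in> verts T. \<chi> x} = card {x \<in> verts T\<^sub>1. \<chi>\<^sub>1 x} + card {x \<in> verts T\<^sub>2. \<chi>\<^sub>2 x}"
    and card: "card (verts T) = k + l"
    using plane_iso_sum_colouring[OF iso assms(1,4) \<chi>] unfolding assms(2,5) .
  have even: "even (card (verts T\<^sub>1))" "even (card (verts T\<^sub>2))" "even (card (verts T))"
    using assms(2,3,5,6) card by auto
  note parity1 = plane_parity_iff_colouring[OF assms(1) \<chi>12(1) even(1), unfolded assms(2)]
    and parity2 = plane_parity_iff_colouring[OF assms(4) \<chi>12(2) even(2), unfolded assms(5)]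
    and parity = plane_parity_iff_colouring(2)[OF assms(7) \<chi> even(3), unfolded card split]
  \<comment> \<open>This removes the cross term of \<open>choose_two_add\<close>, so modulo 2 the
    quantity for \<open>T\<close> is the sum of those for the summands.\<close>
  have "even (k * l)" using assms(3) by simp
  then show ?thesis
    unfolding parity parity1 parity2 choose_two_add even_add by blast
qed

end
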